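(* Let $\{y_i\}_{i=1}^N$ and $\{w_i\}_{i=1}^N$ be the ($N$-point) Gaussian quadrature points and weights on $(-1,1)$, respectively. Let $x(y)\in\mathbb{R}^m$ be the solution to $A(y)x(y)=b$ for $y\in(-1,1)$, with $b\neq0$, and let $\tilde x(y)$ be the subspace solution from the Lagrange subspace $V(\{y_i\}_{i=1}^N)=\mathrm{span}\{x(y_1),\ldots,x(y_N)\}$. Then $$\frac{\|x-\tilde x\|_{L^2(-1,1;\mathbb{R}^m_{A_0})}}{\|x(0)\|_{A_0}}\le\kappa\left(\sqrt2+\sqrt{2(n+1)}\right)\frac{4}{r^2}(1-r)^{n+1}$$ for any $n\le N-1$, where $\kappa=\left(\frac{1+C}{r}\right)^{1/2}$.
   Context: Model problem. $\Omega\subset\mathbb{R}^d$, $d\in\{2,3\}$, is a domain with Lipschitz boundary; $L:H^1_0(\Omega)\to\mathbb{R}$ is a bounded linear functional; $a_0,a_1:H^1_0(\Omega)\times H^1_0(\Omega)\to\mathbb{R}$ are symmetric continuous bilinear forms, $a_0$ is coercive, $a_1$ is positive semidefinite, and $0<r<1$ is such that $a_1(v,v)\le(1-r)a_0(v,v)$ for all $v\in H^1_0(\Omega)$. $C>0$ is a constant such that $|a_1(v,z)|\le C\,a_0(v,v)^{1/2}a_0(z,z)^{1/2}$ for all $v,z\in H^1_0(\Omega)$. $X_h\subset H^1_0(\Omega)$ is a finite-dimensional (finite element) subspace with basis $\{\varphi_i\}_{i=1}^m$. Define $A_0,A_1\in\mathbb{R}^{m\times m}$ by $[A_0]_{ij}=a_0(\varphi_i,\varphi_j)$,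 $[A_1]_{ij}=a_1(\varphi_i,\varphi_j)$, set $A(y)=A_0+yA_1$ for $y\in(-1,1)$, and $b\in\mathbb{R}^m$, $b_i=L(\varphi_i)$. The matrices $A_0$ and $A(y)$ are symmetric positive definite. Subspace solution. For a subspace $V\subset\mathbb{R}^m$ with basis matrix $Q\in\mathbb{R}^{m\times k}$ (columns of $Q$ form a basis of $V$), the subspace solution of $A(y)x(y)=b$ from $V$ is $\tilde x(y)=Qz(y)$, where $Q^TA(y)Qz(y)=Q^Tb$. Norms. $\|z\|_{A_0}=(z^TA_0z)^{1/2}$, and $\mathbb{R}^m_{A_0}$ is $\mathbb{R}^m$ with this norm; $\|f\|_{L^2(-1,1;\mathbb{R}^m_{A_0})}=\left(\int_{-1}^1\|f(y)\|_{A_0}^2\,dy\right)^{1/2}$. Here $n$ is a nonnegative integer (a polynomial degree). *)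

theory Defs
  imports "HOL-Analysis.Analysis" "HOL-Computational_Algebra.Polynomial"
begin

section \<open>Lipschitz domains\<close>

text \<open>Near every boundary point the domain is, in a suitable direction \<open>e\<close>, the strict epigraph of
  a Lipschitz function \<open>\<gamma>\<close> of the coordinates orthogonal to \<open>e\<close>. Boundedness is not required.\<close>

definition lipschitz_boundary :: "(real^'d) set \<Rightarrow> bool" where
  "lipschitz_boundary \<Omega> \<longleftrightarrow>
     (\<forall>p\<in>frontier \<Omega>. \<exists>\<rho>>0. \<exists>e K \<gamma>. norm e = 1 \<and> K-lipschitz_on {z. z \<bullet> e = 0} \<gamma> \<and>
        \<Omega> \<inter> ball p \<rho> = {z \<in> ball p \<rho>. z \<bullet> e > \<gamma> (z - (z \<bullet> e) *\<^sub>R e)})"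

definition lipschitz_domain :: "(real^'d) set \<Rightarrow> bool" where
  "lipschitz_domain \<Omega> \<longleftrightarrow> open \<Omega> \<and> connected \<Omega> \<and> \<Omega> \<noteq> {} \<and> lipschitz_boundary \<Omega>"


section \<open>The Sobolev space $H^1_0(\Omega)$\<close>

text \<open>Elements of $L^2$ and $H^1_0$ are represented by functions on the whole space; only their
  values on \<open>\<Omega>\<close> up to null sets matter. A form that is continuous in the $H^1$ norm automatically
  respects this identification.\<close>

definition partial_deriv :: "'d \<Rightarrow> (real^'d \<Rightarrow> real) \<Rightarrow> real^'d \<Rightarrow> real" where
  "partial_deriv i f = (\<lambda>p. frechet_derivative f (at p) (axis i 1))"

definition grad :: "(real^'d \<Rightarrow> real) \<Rightarrow> real^'d \<Rightarrow> real^'d" where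
  "grad f p = (\<chi> i. partial_deriv i f p)"

fun Ck :: "nat \<Rightarrow> (real^'d \<Rightarrow> real) \<Rightarrow> bool" where
  "Ck 0 f \<longleftrightarrow> continuous_on UNIV f"
| "Ck (Suc k) f \<longleftrightarrow> f differentiable_on UNIV \<and> (\<forall>i. Ck k (partial_deriv i f))"

definition test_functions :: "(real^'d) set \<Rightarrow> (real^'d \<Rightarrow> real) set" where
  "test_functions \<Omega> =
     {f. (\<forall>k. Ck k f) \<and> compact (closure {p. f p \<noteq> 0}) \<and> closure {p. f p \<noteq> 0} \<subseteq> \<Omega>}"

definition in_L2 :: "(real^'d) set \<Rightarrow> (real^'d \<Rightarrow> 'b::euclidean_space) \<Rightarrow> bool" where
  "in_L2 \<Omega> f \<longleftrightarrow> f \<in> borel_measurable (lebesgue_on \<Omega>) \<and>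
     integrable (lebesgue_on \<Omega>) (\<lambda>p. (norm (f p))\<^sup>2)"

definition L2_norm_on :: "(real^'d) set \<Rightarrow> (real^'d \<Rightarrow> 'b::euclidean_space) \<Rightarrow> real" where
  "L2_norm_on \<Omega> f = sqrt (\<integral>p. (norm (f p))\<^sup>2 \<partial>lebesgue_on \<Omega>)"

text \<open>\<open>u \<in> H\<^sup>1(\<Omega>)\<close> with weak gradient \<open>g\<close>.\<close>

definition has_weak_gradient ::
    "(real^'d) set \<Rightarrow> (real^'d \<Rightarrow> real) \<Rightarrow> (real^'d \<Rightarrow> real^'d) \<Rightarrow> bool" where
  "has_weak_gradient \<Omega> u g \<longleftrightarrow> in_L2 \<Omega> u \<and> in_L2 \<Omega> g \<and>
     (\<forall>f\<in>test_functions \<Omega>.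
        (\<integral>p. u p *\<^sub>R grad f p \<partial>lebesgue_on \<Omega>) = - (\<integral>p. f p *\<^sub>R g p \<partial>lebesgue_on \<Omega>))"

text \<open>The weak gradient is unique only up to null sets, which does not affect the norm below.\<close>

definition weak_gradient :: "(real^'d) set \<Rightarrow> (real^'d \<Rightarrow> real) \<Rightarrow> real^'d \<Rightarrow> real^'d" where
  "weak_gradient \<Omega> u = (SOME g. has_weak_gradient \<Omega> u g)"

definition H1_norm :: "(real^'d) set \<Rightarrow> (real^'d \<Rightarrow> real) \<Rightarrow> real" where
  "H1_norm \<Omega> u = sqrt ((L2_norm_on \<Omega> u)\<^sup>2 + (L2_norm_on \<Omega> (weak_gradient \<Omega> u))\<^sup>2)"

text \<open>Closure of the test functions in $H^1(\Omega)$; convergence in the $H^1$ norm is spelled out as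
  $L^2$ convergence of the functions and of their gradients.\<close>

definition H10 :: "(real^'d) set \<Rightarrow> (real^'d \<Rightarrow> real) set" where
  "H10 \<Omega> = {u. \<exists>g. has_weak_gradient \<Omega> u g \<and>
     (\<exists>f. (\<forall>k::nat. f k \<in> test_functions \<Omega>) \<and>
        (\<lambda>k. L2_norm_on \<Omega> (\<lambda>p. f k p - u p)) \<longlonglongrightarrow> 0 \<and>
        (\<lambda>k. L2_norm_on \<Omega> (\<lambda>p. grad (f k) p - g p)) \<longlonglongrightarrow> 0)}"


section \<open>Functionals and bilinear forms on $H^1_0(\Omega)$\<close>

definition linear_functional_on_H10 ::
    "(real^'d) set \<Rightarrow> ((real^'d \<Rightarrow> real) \<Rightarrow> real) \<Rightarrow> bool" where
  "linear_functional_on_H10 \<Omega> L \<longleftrightarrow>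
     (\<forall>u\<in>H10 \<Omega>. \<forall>v\<in>H10 \<Omega>. L (\<lambda>p. u p + v p) = L u + L v) \<and>
     (\<forall>c. \<forall>u\<in>H10 \<Omega>. L (\<lambda>p. c * u p) = c * L u)"

definition bounded_functional_on_H10 ::
    "(real^'d) set \<Rightarrow> ((real^'d \<Rightarrow> real) \<Rightarrow> real) \<Rightarrow> bool" where
  "bounded_functional_on_H10 \<Omega> L \<longleftrightarrow> linear_functional_on_H10 \<Omega> L \<and>
     (\<exists>M. \<forall>v\<in>H10 \<Omega>. \<bar>L v\<bar> \<le> M * H1_norm \<Omega> v)"

definition bilinear_form_on_H10 ::
    "(real^'d) set \<Rightarrow> ((real^'d \<Rightarrow> real) \<Rightarrow> (real^'d \<Rightarrow> real) \<Rightarrow> real) \<Rightarrow> bool" where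
  "bilinear_form_on_H10 \<Omega> a \<longleftrightarrow>
     (\<forall>v\<in>H10 \<Omega>. linear_functional_on_H10 \<Omega> (\<lambda>u. a u v) \<and> linear_functional_on_H10 \<Omega> (a v))"

definition symmetric_on_H10 ::
    "(real^'d) set \<Rightarrow> ((real^'d \<Rightarrow> real) \<Rightarrow> (real^'d \<Rightarrow> real) \<Rightarrow> real) \<Rightarrow> bool" where
  "symmetric_on_H10 \<Omega> a \<longleftrightarrow> (\<forall>u\<in>H10 \<Omega>. \<forall>v\<in>H10 \<Omega>. a u v = a v u)"

definition continuous_form_on_H10 ::
    "(real^'d) set \<Rightarrow> ((real^'d \<Rightarrow> real) \<Rightarrow> (real^'d \<Rightarrow> real) \<Rightarrow> real) \<Rightarrow> bool" where
  "continuous_form_on_H10 \<Omega> a \<longleftrightarrow>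
     (\<exists>M. \<forall>u\<in>H10 \<Omega>. \<forall>v\<in>H10 \<Omega>. \<bar>a u v\<bar> \<le> M * H1_norm \<Omega> u * H1_norm \<Omega> v)"

definition coercive_on_H10 ::
    "(real^'d) set \<Rightarrow> ((real^'d \<Rightarrow> real) \<Rightarrow> (real^'d \<Rightarrow> real) \<Rightarrow> real) \<Rightarrow> bool" where
  "coercive_on_H10 \<Omega> a \<longleftrightarrow> (\<exists>\<alpha>>0. \<forall>v\<in>H10 \<Omega>. a v v \<ge> \<alpha> * (H1_norm \<Omega> v)\<^sup>2)"

definition positive_semidefinite_on_H10 ::
    "(real^'d) set \<Rightarrow> ((real^'d \<Rightarrow> real) \<Rightarrow> (real^'d \<Rightarrow> real) \<Rightarrow> real) \<Rightarrow> bool" where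
  "positive_semidefinite_on_H10 \<Omega> a \<longleftrightarrow> (\<forall>v\<in>H10 \<Omega>. a v v \<ge> 0)"


section \<open>Galerkin discretization\<close>

definition subspace_of_H10 :: "(real^'d) set \<Rightarrow> (real^'d \<Rightarrow> real) set \<Rightarrow> bool" where
  "subspace_of_H10 \<Omega> X \<longleftrightarrow> X \<subseteq> H10 \<Omega> \<and> (\<lambda>p. 0) \<in> X \<and>
     (\<forall>u\<in>X. \<forall>v\<in>X. (\<lambda>p. u p + v p) \<in> X) \<and> (\<forall>c. \<forall>u\<in>X. (\<lambda>p. c * u p) \<in> X)"

text \<open>Linear independence and spanning are understood in $H^1_0(\Omega)$, that is, modulo equality
  almost everywhere.\<close>

definition is_basis_of :: "(real^'d) set \<Rightarrow> (real^'d \<Rightarrow> real) set \<Rightarrow> ('m::finite \<Rightarrow> real^'d \<Rightarrow> real) \<Rightarrow> bool" where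
  "is_basis_of \<Omega> X \<phi> \<longleftrightarrow> (\<forall>i. \<phi> i \<in> X) \<and>
     (\<forall>c. (AE p in lebesgue_on \<Omega>. (\<Sum>i\<in>UNIV. c i * \<phi> i p) = 0) \<longrightarrow> (\<forall>i. c i = 0)) \<and>
     (\<forall>u\<in>X. \<exists>c. AE p in lebesgue_on \<Omega>. u p = (\<Sum>i\<in>UNIV. c i * \<phi> i p))"

definition galerkin_matrix ::
    "((real^'d \<Rightarrow> real) \<Rightarrow> (real^'d \<Rightarrow> real) \<Rightarrow> real) \<Rightarrow> ('m \<Rightarrow> real^'d \<Rightarrow> real) \<Rightarrow> real^'m^'m" where
  "galerkin_matrix a \<phi> = (\<chi> i j. a (\<phi> i) (\<phi> j))"

definition load_vector ::
    "((real^'d \<Rightarrow> real) \<Rightarrow> real) \<Rightarrow> ('m \<Rightarrow> real^'d \<Rightarrow> real) \<Rightarrow> real^'m" where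
  "load_vector L \<phi> = (\<chi> i. L (\<phi> i))"

definition param_matrix :: "real^'m^'m \<Rightarrow> real^'m^'m \<Rightarrow> real \<Rightarrow> real^'m^'m" where
  "param_matrix A0 A1 y = A0 + y *\<^sub>R A1"


section \<open>Subspace solutions and norms\<close>

definition is_basis_matrix :: "real^'k^'m \<Rightarrow> (real^'m) set \<Rightarrow> bool" where
  "is_basis_matrix Q V \<longleftrightarrow> inj (\<lambda>j. column j Q) \<and> independent (columns Q) \<and> span (columns Q) = V"

definition is_subspace_solution ::
    "real^'k^'m \<Rightarrow> real^'m^'m \<Rightarrow> real^'m \<Rightarrow> real^'m \<Rightarrow> bool" where
  "is_subspace_solution Q A b xt \<longleftrightarrow>
     (\<exists>z. (transpose Q ** A ** Q) *v z = transpose Q *v b \<and> xt = Q *v z)"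

definition lagrange_subspace :: "(real \<Rightarrow> real^'m) \<Rightarrow> real set \<Rightarrow> (real^'m) set" where
  "lagrange_subspace x Y = span (x ` Y)"

definition energy_norm :: "real^'m^'m \<Rightarrow> real^'m \<Rightarrow> real" where
  "energy_norm A0 z = sqrt (z \<bullet> (A0 *v z))"

definition L2_energy_norm :: "real^'m^'m \<Rightarrow> (real \<Rightarrow> real^'m) \<Rightarrow> real" where
  "L2_energy_norm A0 f = sqrt (LINT y:{-1<..<1}|lborel. (energy_norm A0 (f y))\<^sup>2)"


section \<open>Gaussian quadrature on $(-1,1)$\<close>

text \<open>Rodrigues' formula.\<close>

definition legendre_poly :: "nat \<Rightarrow> real poly" where
  "legendre_poly N = smult (1 / (2 ^ N * fact N)) ((pderiv ^^ N) ([:-1, 0, 1:] ^ N))"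

text \<open>The points enumerate the \<open>N\<close> (simple) zeros of the Legendre polynomial of degree \<open>N\<close>, in any
  order; the weights are those of the interpolatory rule at these points.\<close>

definition gauss_quadrature :: "nat \<Rightarrow> (nat \<Rightarrow> real) \<Rightarrow> (nat \<Rightarrow> real) \<Rightarrow> bool" where
  "gauss_quadrature N ys w \<longleftrightarrow>
     bij_betw ys {1..N} {t. -1 < t \<and> t < 1 \<and> poly (legendre_poly N) t = 0} \<and>
     (\<forall>i\<in>{1..N}. w i =
        (LINT t:{-1<..<1}|lborel. (\<Prod>j\<in>{1..N} - {i}. (t - ys j) / (ys i - ys j))))"

end

theory Submission
  imports Defs
begin

text \<open>
  By Pythagoras, the subspace solution is the best approximation of \<open>x(y)\<close> from the Lagrange subspace
  in the energy norm of \<open>A(y)\<close>, which is equivalent to that of \<open>A\<^sub>0\<close>; so the error is at most \<open>\<kappa>\<close> times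
  that of the interpolant \<open>v\<close> of \<open>x\<close> at the Gauss points. With \<open>T = A\<^sub>0\<^sup>-\<^sup>1 A\<^sub>1\<close> one has
  \<open>x(0) = x(y) + y T x(y)\<close>, so the truncated Neumann series \<open>p(y) = \<Sum>\<^bsub>k\<le>n\<^esub> (-y)\<^sup>k T\<^sup>k x(0)\<close> satisfies
  \<open>x - p = (-y)\<^bsup>n+1\<^esup> T\<^bsup>n+1\<^esup> x\<close>, which is uniformly at most \<open>\<epsilon> = (1-r)\<^bsup>n+1\<^esup> \<parallel>x(0)\<parallel> / r\<close>. The interpolation
  reproduces \<open>p\<close>, and as the Lagrange basis at the Gauss points is orthogonal, \<open>p - v\<close>
  has squared $L^2$ norm at most \<open>2\<epsilon>\<^sup>2\<close>. Integrating \<open>\<parallel>x - v\<parallel>\<^sup>2 \<le> 2\<parallel>x - p\<parallel>\<^sup>2 + 2\<parallel>p - v\<parallel>\<^sup>2\<close> bounds the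
  $L^2$ error by \<open>2\<surd>2 \<kappa> \<epsilon>\<close>, which is stronger than the claim.
\<close>


section \<open>Galerkin matrices and energy norms\<close>

lemma subspace_of_H10_sum:
  assumes "subspace_of_H10 \<Omega> X" "finite I" "\<forall>i\<in>I. \<phi> i \<in> X"
  shows "(\<lambda>p. \<Sum>i\<in>I. c i * \<phi> i p) \<in> X"
  using assms(2,3,1)
  by (induction I rule: finite_induct) (auto simp: subspace_of_H10_def)

lemma linear_functional_on_H10_sum:
  assumes X: "subspace_of_H10 \<Omega> X" and L: "linear_functional_on_H10 \<Omega> L"
    and "finite I" "\<forall>i\<in>I. \<phi> i \<in> X"
  shows "L (\<lambda>p. \<Sum>i\<in>I. c i * \<phi> i p) = (\<Sum>i\<in>I. c i * L (\<phi> i))"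
  using assms(3,4)
proof (induction I rule: finite_induct)
  case empty
  \<comment> \<open>The empty sum is rewritten as 0 times a member of \<open>H10\<close>, so that
    homogeneity gives the value 0.\<close>
  have "(\<lambda>p. 0) \<in> H10 \<Omega>"
    using X by (auto simp: subspace_of_H10_def)
  moreover have "L (\<lambda>p. 0 * f p) = 0 * L f" if "f \<in> H10 \<Omega>" for f
    using L that unfolding linear_functional_on_H10_def by blast
  ultimately show ?case by fastforce
next
  case (insert i I)
  have sub: "X \<subseteq> H10 \<Omega>"
    using X by (simp add: subspace_of_H10_def)
  have i: "\<phi> i \<in> X" "(\<lambda>p. c i * \<phi> i p) \<in> X"
    using insert X by (auto simp: subspace_of_H10_def)
  have I: "(\<lambda>p. \<Sum>i\<in>I. c i * \<phi> i p) \<in> X"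
    using subspace_of_H10_sum[OF X insert.hyps(1)] insert.prems by simp
  have "L (\<lambda>p. f p + g p) = L f + L g" if "f \<in> X" "g \<in> X" for f g
    using L that sub unfolding linear_functional_on_H10_def by blast
  from this[OF i(2) I] have "L (\<lambda>p. c i * \<phi> i p + (\<Sum>i\<in>I. c i * \<phi> i p))
      = L (\<lambda>p. c i * \<phi> i p) + L (\<lambda>p. \<Sum>i\<in>I. c i * \<phi> i p)" .
  moreover have "L (\<lambda>p. c i * \<phi> i p) = c i * L (\<phi> i)"
    using L i sub unfolding linear_functional_on_H10_def by blast
  ultimately show ?case
    using insert by simp
qed

text \<open>Bilinearity, expanded one argument at a time. This is the bridge over which each
  hypothesis on the forms becomes one on the matrices.\<close>

lemma inner_galerkin_matrix:
  fixes \<phi> :: "'m::finite \<Rightarrow> real^'d \<Rightarrow> real"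
  assumes X: "subspace_of_H10 \<Omega> X" and a: "bilinear_form_on_H10 \<Omega> a" and \<phi>: "\<forall>i. \<phi> i \<in> X"
  shows "u \<bullet> (galerkin_matrix a \<phi> *v v)
    = a (\<lambda>p. \<Sum>i\<in>UNIV. u $ i * \<phi> i p) (\<lambda>p. \<Sum>i\<in>UNIV. v $ i * \<phi> i p)"
proof -
  let ?v = "\<lambda>p. \<Sum>i\<in>UNIV. v $ i * \<phi> i p"
  have sub: "X \<subseteq> H10 \<Omega>"
    using X by (simp add: subspace_of_H10_def)
  have v: "?v \<in> H10 \<Omega>"
    using subspace_of_H10_sum[OF X, of UNIV \<phi> "($) v"] \<phi> sub by auto
  have "a (\<lambda>p. \<Sum>i\<in>UNIV. u $ i * \<phi> i p) ?v = (\<Sum>i\<in>UNIV. u $ i * a (\<phi> i) ?v)"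
    using a v \<phi> unfolding bilinear_form_on_H10_def
    by (intro linear_functional_on_H10_sum[OF X, of "\<lambda>f. a f ?v"]) auto
  also have "\<dots> = (\<Sum>i\<in>UNIV. u $ i * (\<Sum>j\<in>UNIV. v $ j * a (\<phi> i) (\<phi> j)))"
    using a sub \<phi> unfolding bilinear_form_on_H10_def
    by (intro sum.cong refl arg_cong2[where f = "(*)"] linear_functional_on_H10_sum[OF X]) auto
  finally show ?thesis
    by (simp add: inner_vec_def matrix_vector_mult_def galerkin_matrix_def mult.commute)
qed

lemma transpose_galerkin_matrix:
  assumes "subspace_of_H10 \<Omega> X" "symmetric_on_H10 \<Omega> a" "\<forall>i. \<phi> i \<in> X"
  shows "transpose (galerkin_matrix a \<phi>) = galerkin_matrix a \<phi>"
  using assms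
  by (auto simp: galerkin_matrix_def transpose_def vec_eq_iff symmetric_on_H10_def subspace_of_H10_def)

text \<open>The $H^1$ norm dominates the $L^2$ norm, and a nonnegative integrand with integral 0
  vanishes a.e. Membership in \<open>H10\<close> supplies the integrability; a non-integrable square
  would also have integral 0.\<close>

lemma H1_norm_eq_0_imp_AE:
  assumes "v \<in> H10 \<Omega>" "H1_norm \<Omega> v = 0"
  shows "AE p in lebesgue_on \<Omega>. v p = 0"
proof -
  have "in_L2 \<Omega> v"
    using assms(1) by (auto simp: H10_def has_weak_gradient_def)
  then have i: "integrable (lebesgue_on \<Omega>) (\<lambda>p. (norm (v p))\<^sup>2)"
    by (simp add: in_L2_def)
  have "L2_norm_on \<Omega> v = 0"
    using assms(2) by (simp add: H1_norm_def sum_power2_eq_zero_iff)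
  then have "(\<integral>p. (norm (v p))\<^sup>2 \<partial>lebesgue_on \<Omega>) = 0"
    by (simp add: L2_norm_on_def)
  then show ?thesis
    using integral_nonneg_eq_0_iff_AE[OF i] by simp
qed

text \<open>Coercivity leaves only functions of zero $H^1$ norm to exclude. Such a combination is 0
  a.e., and independence modulo null sets then forces zero coordinates.\<close>

lemma galerkin_matrix_pos_def:
  fixes \<phi> :: "'m::finite \<Rightarrow> real^'d \<Rightarrow> real"
  assumes X: "subspace_of_H10 \<Omega> X" and a: "bilinear_form_on_H10 \<Omega> a" "coercive_on_H10 \<Omega> a"
    and \<phi>: "is_basis_of \<Omega> X \<phi>" and "u \<noteq> 0"
  shows "u \<bullet> (galerkin_matrix a \<phi> *v u) > 0"
proof -
  let ?u = "\<lambda>p. \<Sum>i\<in>UNIV. u $ i * \<phi> i p"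
  have \<phi>X: "\<forall>i. \<phi> i \<in> X"
    using \<phi> by (simp add: is_basis_of_def)
  have u: "?u \<in> H10 \<Omega>"
    using subspace_of_H10_sum[OF X, of UNIV \<phi> "($) u"] \<phi>X X by (auto simp: subspace_of_H10_def)
  obtain \<alpha> where \<alpha>: "\<alpha> > 0" "a ?u ?u \<ge> \<alpha> * (H1_norm \<Omega> ?u)\<^sup>2"
    using a(2) u unfolding coercive_on_H10_def by blast
  have "H1_norm \<Omega> ?u \<noteq> 0"
  proof
    assume "H1_norm \<Omega> ?u = 0"
    then have "AE p in lebesgue_on \<Omega>. ?u p = 0"
      using H1_norm_eq_0_imp_AE u by blast
    then have "\<forall>i. u $ i = 0"
      using \<phi> unfolding is_basis_of_def by blast
    then show False
      using \<open>u \<noteq> 0\<close> by (simp add: vec_eq_iff)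
  qed
  then have "\<alpha> * (H1_norm \<Omega> ?u)\<^sup>2 > 0"
    using \<alpha>(1) by simp
  then show ?thesis
    using \<alpha>(2) inner_galerkin_matrix[OF X a(1) \<phi>X, of u u] by linarith
qed

section \<open>Symmetric positive semidefinite matrices and quasi-optimality\<close>

lemma inner_symmetric_matrix:
  fixes A :: "real^'m^'m"
  assumes "transpose A = A"
  shows "u \<bullet> (A *v v) = v \<bullet> (A *v u)"
  by (metis assms dot_lmul_matrix inner_commute transpose_matrix_vector)

text \<open>The quadratic form is nonnegative at every \<open>s u - t v\<close>. Semidefiniteness
  must suffice because \<open>A1\<close> may have a kernel, hence the separate case
  \<open>?c = 0\<close>.\<close>

lemma psd_matrix_Cauchy_Schwarz:
  fixes A :: "real^'m^'m"
  assumes sym: "transpose A = A" and psd: "\<And>z. z \<bullet> (A *v z) \<ge> 0"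
  shows "(u \<bullet> (A *v v))\<^sup>2 \<le> (u \<bullet> (A *v u)) * (v \<bullet> (A *v v))"
proof -
  let ?a = "u \<bullet> (A *v u)" and ?c = "v \<bullet> (A *v v)" and ?d = "u \<bullet> (A *v v)"
  have expand: "s\<^sup>2 * ?a - 2 * s * t * ?d + t\<^sup>2 * ?c \<ge> 0" for s t
    using psd[of "s *\<^sub>R u - t *\<^sub>R v"] inner_symmetric_matrix[OF sym, of v u]
    by (simp add: algebra_simps matrix_vector_mult_diff_distrib matrix_vector_mult_scaleR
        inner_diff_left inner_diff_right power2_eq_square)
  show ?thesis
  proof (cases "?c = 0")
    case True
    have "?d = 0"
    proof (rule ccontr)
      assume "?d \<noteq> 0"
      then show False
        \<comment> \<open>With \<open>?c = 0\<close> and s = 1 the form is affine in t; this t gives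
          it the value -1.\<close>
        using expand[of 1 "(?a + 1) / (2 * ?d)"] True psd[of u] by (simp add: field_simps)
    qed
    then show ?thesis using True by simp
  next
    case False
    then have "?c > 0" using psd[of v] by linarith
    moreover have "?c * (?a * ?c - ?d\<^sup>2) \<ge> 0"
      using expand[of ?c ?d] by (simp add: algebra_simps power2_eq_square)
    ultimately show ?thesis
      by (simp add: zero_le_mult_iff)
  qed
qed

text \<open>The parallelogram law with the nonnegative term at \<open>u - v\<close> dropped.\<close>

lemma psd_matrix_parallelogram:
  fixes A :: "real^'m^'m"
  assumes psd: "\<And>z. z \<bullet> (A *v z) \<ge> 0"
  shows "(u + v) \<bullet> (A *v (u + v)) \<le> 2 * (u \<bullet> (A *v u)) + 2 * (v \<bullet> (A *v v))"
  using psd[of "u - v"]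
  by (simp add: algebra_simps matrix_vector_mult_diff_distrib matrix_vector_right_distrib
        inner_diff_left inner_diff_right inner_add_left inner_add_right)

lemma inner_param_matrix:
  "u \<bullet> (param_matrix A0 A1 y *v v) = u \<bullet> (A0 *v v) + y * (u \<bullet> (A1 *v v))"
  by (simp add: param_matrix_def matrix_vector_mult_add_rdistrib scaleR_matrix_vector_assoc[symmetric]
      inner_add_right)

text \<open>Pythagoras: the error is \<open>A\<close>-orthogonal to the column space.\<close>

lemma subspace_solution_quasi_optimal:
  fixes Q :: "real^'k^'m" and A :: "real^'m^'m"
  assumes sym: "transpose A = A" and psd: "\<And>z. z \<bullet> (A *v z) \<ge> 0"
    and x: "A *v x = b" and xt: "is_subspace_solution Q A b xt" and v: "v \<in> span (columns Q)"
  shows "(x - xt) \<bullet> (A *v (x - xt)) \<le> (x - v) \<bullet> (A *v (x - v))"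
proof -
  obtain z where z: "(transpose Q ** A ** Q) *v z = transpose Q *v b" "xt = Q *v z"
    using xt by (auto simp: is_subspace_solution_def)
  have "span (columns Q) \<subseteq> range ((*v) Q)"
    by (intro span_minimal linear_subspace_image[of _ UNIV] matrix_vector_mul_linear subspace_UNIV)
      (auto simp: columns_def matrix_vector_mult_basis[symmetric])
  then obtain u where u: "v = Q *v u"
    using v by blast
  have ortho: "(Q *v c) \<bullet> (A *v (x - xt)) = 0" for c
  proof -
    have "(Q *v c) \<bullet> (A *v (x - xt)) = c \<bullet> (transpose Q *v (A *v (x - xt)))"
      by (metis dot_lmul_matrix inner_commute transpose_matrix_vector)
    also have "transpose Q *v (A *v (x - xt)) = 0"
      using z x by (simp add: matrix_vector_mult_diff_distrib matrix_vector_mul_assoc matrix_mul_assoc)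
    finally show ?thesis by simp
  qed
  let ?e = "x - xt" and ?w = "xt - v"
  have w: "?w = Q *v (z - u)"
    using z(2) u by (simp add: matrix_vector_mult_diff_distrib)
  have "(?e + ?w) \<bullet> (A *v (?e + ?w)) = ?e \<bullet> (A *v ?e) + 2 * (?w \<bullet> (A *v ?e)) + ?w \<bullet> (A *v ?w)"
    using inner_symmetric_matrix[OF sym, of ?e ?w]
    by (simp only: matrix_vector_right_distrib inner_add_left inner_add_right)
  moreover have "?w \<bullet> (A *v ?e) = 0"
    unfolding w by (rule ortho)
  ultimately have "?e \<bullet> (A *v ?e) \<le> (?e + ?w) \<bullet> (A *v (?e + ?w))"
    using psd[of ?w] by linarith
  moreover have "?e + ?w = x - v"
    by simp
  ultimately show ?thesis
    by (simp only:)
qed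

section \<open>Energy bounds from the domination of \<open>A1\<close> by \<open>A0\<close>\<close>

context
  fixes A0 A1 :: "real^'m^'m" and r y :: real
  assumes sym0: "transpose A0 = A0" and sym1: "transpose A1 = A1"
    and psd0: "\<And>z. z \<bullet> (A0 *v z) \<ge> 0" and psd1: "\<And>z. z \<bullet> (A1 *v z) \<ge> 0"
    and dominated: "\<And>z. z \<bullet> (A1 *v z) \<le> (1 - r) * (z \<bullet> (A0 *v z))"
    and r: "0 < r" "r < 1"
begin

text \<open>For invertible \<open>A0\<close> this makes $A_0^{-1}A_1$ a contraction with factor
  \<open>1 - r\<close>. Testing with \<open>u\<close> and using Cauchy-Schwarz for \<open>A1\<close>
  lets the domination act on both factors; one factor of the energy of \<open>u\<close> then
  cancels.\<close>

lemma energy_quotient_le: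
  assumes "A0 *v u = A1 *v v"
  shows "u \<bullet> (A0 *v u) \<le> (1 - r)\<^sup>2 * (v \<bullet> (A0 *v v))"
proof (cases "u \<bullet> (A0 *v u) = 0")
  case True
  then show ?thesis using psd0[of v] by simp
next
  case False
  let ?q = "u \<bullet> (A0 *v u)"
  have pos: "?q > 0" using False psd0[of u] by simp
  have "?q\<^sup>2 \<le> (u \<bullet> (A1 *v u)) * (v \<bullet> (A1 *v v))"
    using psd_matrix_Cauchy_Schwarz[OF sym1 psd1, of u v] assms by simp
  also have "\<dots> \<le> ((1 - r) * ?q) * ((1 - r) * (v \<bullet> (A0 *v v)))"
    using dominated psd1 psd0 r by (intro mult_mono) auto
  finally have "?q * ?q \<le> ?q * ((1 - r)\<^sup>2 * (v \<bullet> (A0 *v v)))"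
    by (simp add: power2_eq_square algebra_simps)
  then show ?thesis
    using pos by simp
qed

lemma param_matrix_lower_bound:
  assumes "\<bar>y\<bar> \<le> 1"
  shows "r * (z \<bullet> (A0 *v z)) \<le> z \<bullet> (param_matrix A0 A1 y *v z)"
proof -
  have "\<bar>y * (z \<bullet> (A1 *v z))\<bar> \<le> 1 * ((1 - r) * (z \<bullet> (A0 *v z)))"
    unfolding abs_mult using assms dominated[of z] psd1[of z] by (intro mult_mono) auto
  then show ?thesis
    by (simp add: inner_param_matrix algebra_simps abs_le_iff)
qed

text \<open>Testing the equation with \<open>x\<close> bounds r times its energy by
  \<open>x \<bullet> (A0 *v x0)\<close>; Cauchy-Schwarz for \<open>A0\<close> and cancelling one
  factor finish.\<close>

lemma resolvent_bound:
  assumes y: "\<bar>y\<bar> \<le> 1" and x: "param_matrix A0 A1 y *v x = A0 *v x0"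
  shows "x \<bullet> (A0 *v x) \<le> (x0 \<bullet> (A0 *v x0)) / r\<^sup>2"
proof (cases "x \<bullet> (A0 *v x) = 0")
  case True
  then show ?thesis using psd0[of x0] by simp
next
  case False
  let ?q = "x \<bullet> (A0 *v x)"
  have pos: "?q > 0" using False psd0[of x] by simp
  have "r * ?q \<le> x \<bullet> (A0 *v x0)"
    using param_matrix_lower_bound[OF y, of x] x by simp
  then have "(r * ?q)\<^sup>2 \<le> (x \<bullet> (A0 *v x0))\<^sup>2"
    using r pos by (intro power_mono) auto
  also have "\<dots> \<le> ?q * (x0 \<bullet> (A0 *v x0))"
    by (rule psd_matrix_Cauchy_Schwarz[OF sym0 psd0])
  finally have "?q * (r\<^sup>2 * ?q) \<le> ?q * (x0 \<bullet> (A0 *v x0))"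
    by (simp add: power2_eq_square algebra_simps)
  then have "r\<^sup>2 * ?q \<le> x0 \<bullet> (A0 *v x0)"
    using pos by simp
  then show ?thesis
    using r by (simp add: field_simps)
qed

lemma energy_iterate_le:
  assumes T: "\<And>v. A0 *v (T v) = A1 *v v"
  shows "(T ^^ k) v \<bullet> (A0 *v (T ^^ k) v) \<le> (1 - r) ^ (2 * k) * (v \<bullet> (A0 *v v))"
proof (induction k)
  case (Suc k)
  have "(T ^^ Suc k) v \<bullet> (A0 *v (T ^^ Suc k) v) \<le> (1 - r)\<^sup>2 * ((T ^^ k) v \<bullet> (A0 *v (T ^^ k) v))"
    using energy_quotient_le T by simp
  also have "\<dots> \<le> (1 - r)\<^sup>2 * ((1 - r) ^ (2 * k) * (v \<bullet> (A0 *v v)))"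
    using Suc by (intro mult_left_mono) auto
  finally show ?case
    by (simp add: power2_eq_square algebra_simps)
qed simp

end

text \<open>Applying \<open>T ^^ k\<close> to the second hypothesis expresses each summand by two
  consecutive iterates of \<open>x\<close>, so the sum telescopes. The identity is exact and
  involves no convergence.\<close>

lemma neumann_series_remainder:
  fixes T :: "'a::real_vector \<Rightarrow> 'a"
  assumes "linear T" "x0 = x + y *\<^sub>R T x"
  shows "x - (\<Sum>k\<le>n. (- y) ^ k *\<^sub>R (T ^^ k) x0) = (- y) ^ (n + 1) *\<^sub>R (T ^^ (n + 1)) x"
proof -
  have "linear (T ^^ k)" for k
    using assms(1) by (induction k) (simp_all only: funpow.simps linear_id linear_compose)
  then have step: "(T ^^ k) x0 = (T ^^ k) x + y *\<^sub>R (T ^^ Suc k) x" for k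
    using assms(2) by (simp add: linear_add linear_scale funpow_swap1)
  show ?thesis
    by (induction n) (use assms(2) step in \<open>auto simp: algebra_simps funpow_swap1\<close>)
qed


section \<open>Lagrange interpolation at the Legendre zeros\<close>

text \<open>Nodes form a set, so their enumeration is irrelevant; values are formal polynomials, so
  degrees and factorizations are at hand.\<close>

definition lagrange_basis :: "real set \<Rightarrow> real \<Rightarrow> real poly" where
  "lagrange_basis S s = smult (1 / (\<Prod>t\<in>S - {s}. s - t)) (\<Prod>t\<in>S - {s}. [:- t, 1:])"

lemma poly_lagrange_basis:
  assumes "finite S" "s \<in> S" "t \<in> S"
  shows "poly (lagrange_basis S s) t = (if s = t then 1 else 0)"
proof (cases "s = t")
  case True
  then show ?thesis
    using assms by (simp add: lagrange_basis_def poly_prod)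
next
  case False
  then have "(\<Prod>u\<in>S - {s}. t - u) = 0"
    using assms by auto
  with False show ?thesis
    by (simp add: lagrange_basis_def poly_prod)
qed

lemma degree_prod_linear:
  "degree (\<Prod>t\<in>S. [:- t, 1 :: real:]) = card S"
  by (subst degree_prod_eq_sum_degree) auto

lemma degree_lagrange_basis:
  assumes "finite S" "s \<in> S"
  shows "degree (lagrange_basis S s) < card S"
proof -
  have "card S > 0"
    using assms by (auto simp: card_gt_0_iff)
  then show ?thesis
    using assms degree_smult_le[of "1 / (\<Prod>t\<in>S - {s}. s - t)" "\<Prod>t\<in>S - {s}. [:- t, 1:]"]
    by (simp add: lagrange_basis_def degree_prod_linear)
qed

lemma poly_eq_0_if_many_roots:
  fixes p :: "real poly"
  assumes "finite S" "degree p < card S" "\<forall>s\<in>S. poly p s = 0"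
  shows "p = 0"
proof (rule ccontr)
  assume "p \<noteq> 0"
  then have "card S \<le> card {s. poly p s = 0}"
    using assms by (intro card_mono poly_roots_finite) auto
  also have "\<dots> \<le> degree p"
    using \<open>p \<noteq> 0\<close> by (rule card_poly_roots_bound)
  finally show False
    using assms(2) by simp
qed

text \<open>The difference of the two sides has fewer than \<open>card S\<close> as degree and
  vanishes on all of \<open>S\<close>.\<close>

lemma lagrange_interpolation:
  assumes "finite S" "degree p < card S"
  shows "p = (\<Sum>s\<in>S. smult (poly p s) (lagrange_basis S s))"
proof -
  let ?d = "p - (\<Sum>s\<in>S. smult (poly p s) (lagrange_basis S s))"
  have "degree (smult (poly p s) (lagrange_basis S s)) < card S" if "s \<in> S" for s
    using degree_lagrange_basis[OF assms(1) that] degree_smult_le le_less_trans by blast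
  then have "degree (\<Sum>s\<in>S. smult (poly p s) (lagrange_basis S s)) < card S"
    using assms by (intro degree_sum_less) auto
  then have "degree ?d < card S"
    using assms(2) by (rule degree_diff_less[rotated])
  moreover have "poly ?d t = 0" if "t \<in> S" for t
    using assms(1) that
    by (simp add: poly_sum poly_lagrange_basis if_distrib[of "(*) _"] cong: if_cong)
  ultimately have "?d = 0"
    using poly_eq_0_if_many_roots[OF assms(1)] by blast
  then show ?thesis by simp
qed

section \<open>Orthogonality of Legendre polynomials\<close>

abbreviation legendre_zeros :: "nat \<Rightarrow> real set" where
  "legendre_zeros N \<equiv> {t. -1 < t \<and> t < 1 \<and> poly (legendre_poly N) t = 0}"

lemma set_integrable_poly:
  "set_integrable lborel {-1<..<1} (poly (p :: real poly))"
  by (rule set_integrable_subset[OF borel_integrable_atLeastAtMost'[of "-1" 1]])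
    (auto intro: continuous_intros)

lemma set_integral_sum:
  fixes f :: "'i \<Rightarrow> 'a \<Rightarrow> 'b::{banach, second_countable_topology}"
  assumes "\<And>i. i \<in> I \<Longrightarrow> set_integrable M A (f i)"
  shows "set_integrable M A (\<lambda>x. \<Sum>i\<in>I. f i x)"
    and "(LINT x:A|M. \<Sum>i\<in>I. f i x) = (\<Sum>i\<in>I. LINT x:A|M. f i x)"
  using assms
  by (simp_all add: set_integrable_def set_lebesgue_integral_def scaleR_sum_right)

lemma integral_pderiv:
  "(LINT t:{-1<..<1}|lborel. poly (pderiv p) t) = poly p 1 - poly p (-1 :: real)"
proof -
  have "(LBINT t=ereal (-1)..ereal 1. poly (pderiv p) t) = poly p 1 - poly p (-1)"
    by (rule interval_integral_FTC_finite)
      (auto intro!: continuous_intros simp: has_real_derivative_iff_has_vector_derivative[symmetric]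
        intro: DERIV_subset[OF poly_DERIV])
  then show ?thesis
    by (simp add: interval_lebesgue_integral_le_eq)
qed

text \<open>By the product rule, a derivative costs at most one factor \<open>w\<close>. Iterated
  below, it makes the boundary terms of the integrations by parts vanish.\<close>

lemma power_dvd_pderiv:
  fixes p :: "real poly"
  assumes "w ^ Suc k dvd p"
  shows "w ^ k dvd pderiv p"
proof -
  obtain q where "p = w ^ Suc k * q"
    using assms by blast
  then have "pderiv p = w ^ k * (w * pderiv q + smult (of_nat (Suc k)) (pderiv w * q))"
    by (simp add: pderiv_mult pderiv_power_Suc distrib_left mult_ac del: power_Suc of_nat_Suc) simp
  then show ?thesis
    by simp
qed

lemma power_dvd_higher_pderiv:
  fixes p :: "real poly"
  assumes "w ^ (k + j) dvd p"
  shows "w ^ j dvd (pderiv ^^ k) p"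
  using assms
proof (induction k arbitrary: j)
  case (Suc k)
  have "w ^ (k + Suc j) dvd p"
    using Suc.prems by simp
  then have "w ^ Suc j dvd (pderiv ^^ k) p"
    by (rule Suc.IH)
  then show ?case
    by (simp del: power_Suc add: power_dvd_pderiv)
qed simp

text \<open>Repeated integration by parts: each step moves one derivative to \<open>q\<close>, and
  the boundary terms vanish because the lower derivatives of \<open>p\<close> keep a factor $t^2-1$.
  The degree of \<open>q\<close> runs out first.\<close>

lemma higher_pderiv_orthogonal:
  fixes p q :: "real poly"
  assumes "[:-1, 0, 1:] ^ k dvd p" "degree q < k"
  shows "(LINT t:{-1<..<1}|lborel. poly ((pderiv ^^ k) p * q) t) = 0"
  using assms
proof (induction k arbitrary: q)
  case (Suc k)
  let ?f = "(pderiv ^^ k) p"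
  have "[:-1, 0, 1:] ^ 1 dvd ?f"
    using Suc.prems(1) by (intro power_dvd_higher_pderiv) simp
  then have bd: "poly ?f 1 = 0" "poly ?f (-1) = 0"
    by (auto elim!: dvdE)
  have "(LINT t:{-1<..<1}|lborel. poly (?f * pderiv q) t) = 0"
  \<comment> \<open>Constant \<open>q\<close> is treated apart: its derivative has degree 0, which
    is not below \<open>k\<close> when \<open>k = 0\<close>.\<close>
  proof (cases "pderiv q = 0")
    case False
    then have "degree (pderiv q) < k"
      using Suc.prems(2) by (auto simp: degree_pderiv pderiv_eq_0_iff)
    then show ?thesis
      using Suc.IH Suc.prems(1) by (meson dvd_trans le_imp_power_dvd le_SucI order_refl)
  qed (simp add: set_lebesgue_integral_def)
  moreover have "(LINT t:{-1<..<1}|lborel. poly (pderiv (?f * q)) t) = 0"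
    using bd by (simp only: integral_pderiv) simp
  moreover have "(LINT t:{-1<..<1}|lborel. poly (pderiv (?f * q)) t)
      = (LINT t:{-1<..<1}|lborel. poly (?f * pderiv q) t)
      + (LINT t:{-1<..<1}|lborel. poly (pderiv ?f * q) t)"
    using set_integral_add(2)[OF set_integrable_poly[of "?f * pderiv q"] set_integrable_poly[of "pderiv ?f * q"]]
    by (simp add: pderiv_mult mult.commute add.commute)
  ultimately show ?case
    by simp
qed simp

lemma legendre_poly_orthogonal:
  assumes "degree q < N"
  shows "(LINT t:{-1<..<1}|lborel. poly (legendre_poly N * q) t) = 0"
  using higher_pderiv_orthogonal[of N "[:-1, 0, 1:] ^ N" q] assms
  by (simp add: legendre_poly_def mult.assoc)

lemma degree_legendre_poly: "degree (legendre_poly N) = N"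
proof -
  have "degree ((pderiv ^^ k) p) = degree p - k" for k and p :: "real poly"
    by (induction k) (auto simp: degree_pderiv)
  then show ?thesis
    by (simp add: legendre_poly_def degree_power_eq)
qed

section \<open>Lagrange basis at the Gauss points\<close>

context
  fixes N :: nat
  assumes card_zeros: "card (legendre_zeros N) = N" and N: "N \<ge> 1"
begin

lemma finite_legendre_zeros: "finite (legendre_zeros N)"
  using card_zeros N by (metis card.infinite not_one_le_zero)

text \<open>By \<open>card_zeros\<close> there are as many distinct zeros as the degree. Subtracting
  the right-hand side cancels the top coefficient, leaving degree below \<open>N\<close> with
  \<open>N\<close> zeros.\<close>

lemma legendre_poly_factorization:
  "legendre_poly N = smult (lead_coeff (legendre_poly N)) (\<Prod>t\<in>legendre_zeros N. [:- t, 1:])"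
proof -
  let ?S = "legendre_zeros N" and ?P = "legendre_poly N"
  define W where "W = (\<Prod>t\<in>?S. [:- t, 1:])"
  define D where "D = ?P - smult (lead_coeff ?P) W"
  have W: "degree W = N"
    unfolding W_def using degree_prod_linear card_zeros by simp
  have "lead_coeff W = 1"
    unfolding W_def lead_coeff_prod by simp
  then have D_coeff: "coeff D N = 0"
    using W by (simp add: D_def degree_legendre_poly)
  have D_degree: "degree D \<le> N"
    unfolding D_def
    using W degree_legendre_poly[of N] degree_smult_le[of _ W] by (intro degree_diff_le) auto
  have "degree D \<noteq> N"
  proof
    assume "degree D = N"
    then have "D = 0"
      using D_coeff leading_coeff_0_iff by blast
    then show False
      using \<open>degree D = N\<close> N by simp
  qed
  then have "degree D < N"
    using D_degree by simp
  moreover have "poly D t = 0" if "t \<in> ?S" for t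
    using that finite_legendre_zeros by (auto simp: D_def W_def poly_prod prod_zero_iff)
  ultimately have "D = 0"
    using poly_eq_0_if_many_roots[OF finite_legendre_zeros] card_zeros by simp
  then show ?thesis
    by (simp add: D_def W_def)
qed

text \<open>The node missing from each basis polynomial is supplied by the other one, so the product
  is divisible by the Legendre polynomial, with a quotient of degree below \<open>N\<close>.\<close>

lemma lagrange_basis_orthogonal:
  assumes "s \<in> legendre_zeros N" "t \<in> legendre_zeros N" "s \<noteq> t"
  shows "(LINT u:{-1<..<1}|lborel. poly (lagrange_basis (legendre_zeros N) s) u
      * poly (lagrange_basis (legendre_zeros N) t) u) = 0"
proof -
  define S where "S = legendre_zeros N"
  define P where "P = legendre_poly N"
  define W where "W = (\<lambda>R. \<Prod>t\<in>R. [:- t, 1:] :: real poly)"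
  define a where "a = (\<lambda>s. 1 / (\<Prod>u\<in>S - {s}. s - u))"
  have st: "s \<in> S" "t \<in> S" and fin: "finite S"
    using assms finite_legendre_zeros by (simp_all add: S_def)
  have "P \<noteq> 0"
    using degree_legendre_poly[of N] N by (auto simp: P_def)
  \<comment> \<open>The quotient by \<open>P\<close>: the linear factors that occur in both basis
    polynomials, rescaled.\<close>
  define q where "q = smult (a s * a t / lead_coeff P) (W (S - {s, t}))"
  have "W (S - {s}) = [:- t, 1:] * W (S - {s} - {t})"
    unfolding W_def using st \<open>s \<noteq> t\<close> fin by (intro prod.remove) auto
  moreover have "S - {s} - {t} = S - {s, t}"
    by blast
  moreover have "W S = [:- t, 1:] * W (S - {t})"
    unfolding W_def using st fin by (intro prod.remove) auto
  ultimately have "W (S - {s}) * W (S - {t}) = W S * W (S - {s, t})"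
    by (simp only: mult_ac)
  moreover have "lagrange_basis S u = smult (a u) (W (S - {u}))" for u
    by (simp add: lagrange_basis_def a_def W_def)
  ultimately have "lagrange_basis S s * lagrange_basis S t = smult (a s * a t) (W S * W (S - {s, t}))"
    by (simp add: mult.commute[of "a s" "a t"])
  also have "\<dots> = smult (lead_coeff P) (W S) * q"
    using \<open>P \<noteq> 0\<close> by (simp add: q_def)
  also have "smult (lead_coeff P) (W S) = P"
    unfolding P_def W_def S_def by (rule legendre_poly_factorization[symmetric])
  finally have eq: "lagrange_basis S s * lagrange_basis S t = P * q" .
  have "card (S - {s, t}) < card S"
    using st fin by (intro psubset_card_mono) auto
  then have "degree q < N"
    unfolding q_def using degree_prod_linear[of "S - {s, t}"] card_zeros
      degree_smult_le[of "a s * a t / lead_coeff P" "W (S - {s, t})"]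
    by (simp add: S_def W_def)
  then have "(LINT u:{-1<..<1}|lborel. poly (lagrange_basis S s * lagrange_basis S t) u) = 0"
    unfolding eq P_def by (rule legendre_poly_orthogonal)
  then show ?thesis
    by (simp add: S_def)
qed

text \<open>Orthogonality removes the off-diagonal terms. The kernel \<open>G\<close> is arbitrary,
  to serve both the constant 1 (sum of the weights) and the energy products of nodal
  vectors.\<close>

lemma integral_lagrange_quadratic:
  fixes G :: "real \<Rightarrow> real \<Rightarrow> real"
  defines "S \<equiv> legendre_zeros N"
  shows "set_integrable lborel {-1<..<1}
      (\<lambda>y. \<Sum>s\<in>S. \<Sum>t\<in>S. poly (lagrange_basis S s) y * poly (lagrange_basis S t) y * G s t)"
    (is "set_integrable _ _ ?f")
    and "(LINT y:{-1<..<1}|lborel.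
        \<Sum>s\<in>S. \<Sum>t\<in>S. poly (lagrange_basis S s) y * poly (lagrange_basis S t) y * G s t)
      = (\<Sum>s\<in>S. (LINT y:{-1<..<1}|lborel. poly (lagrange_basis S s) y * poly (lagrange_basis S s) y) * G s s)"
proof -
  let ?I = "\<lambda>f. LINT y:{-1<..<1}|lborel. f y"
  let ?l = "\<lambda>s y. poly (lagrange_basis S s) y"
  have fin: "finite S"
    unfolding S_def by (rule finite_legendre_zeros)
  have int: "set_integrable lborel {-1<..<1} (\<lambda>y. ?l s y * ?l t y * G s t)" for s t
    using set_integrable_poly[of "lagrange_basis S s * lagrange_basis S t"]
    by (intro set_integrable_mult_left) (simp add: poly_mult[abs_def])
  then show "set_integrable lborel {-1<..<1} ?f"
    by (intro set_integral_sum(1))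
  have "?I ?f = (\<Sum>s\<in>S. \<Sum>t\<in>S. ?I (\<lambda>y. ?l s y * ?l t y * G s t))"
    using int by (simp add: set_integral_sum)
  also have "\<dots> = (\<Sum>s\<in>S. \<Sum>t\<in>S. if s = t then ?I (\<lambda>y. ?l s y * ?l s y) * G s s else 0)"
    using lagrange_basis_orthogonal unfolding S_def by (intro sum.cong refl) auto
  also have "\<dots> = (\<Sum>s\<in>S. ?I (\<lambda>y. ?l s y * ?l s y) * G s s)"
    using fin by simp
  finally show "?I ?f = (\<Sum>s\<in>S. ?I (\<lambda>y. ?l s y * ?l s y) * G s s)" .
qed

text \<open>The numbers \<open>\<integral> l\<^sub>s\<^sup>2\<close> are the Gauss weights; their sum is \<open>\<integral> (\<Sum> l\<^sub>s)\<^sup>2 = \<integral> 1\<close>.\<close>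

lemma sum_integral_lagrange_squares:
  defines "S \<equiv> legendre_zeros N"
  shows "(\<Sum>s\<in>S. LINT y:{-1<..<1}|lborel. poly (lagrange_basis S s) y * poly (lagrange_basis S s) y) = 2"
proof -
  have "(1 :: real poly) = (\<Sum>s\<in>S. lagrange_basis S s)"
    using lagrange_interpolation[of S 1] finite_legendre_zeros card_zeros N unfolding S_def by simp
  then have one: "(\<Sum>s\<in>S. poly (lagrange_basis S s) y) = 1" for y
    by (metis poly_1 poly_sum)
  have "(\<Sum>s\<in>S. \<Sum>t\<in>S. poly (lagrange_basis S s) y * poly (lagrange_basis S t) y * 1) = 1" for y
    by (simp add: one sum_distrib_left[symmetric])
  then show ?thesis
    using integral_lagrange_quadratic(2)[of "\<lambda>_ _. 1"]
    unfolding S_def by (simp add: set_lebesgue_integral_def)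
qed

text \<open>Stability of interpolation: the integral is the sum of nodal energies with nonnegative
  weights of total 2, so a bound at the nodes passes to the integral with no constant depending on
  \<open>N\<close>.\<close>

lemma lagrange_energy_integral:
  fixes A :: "real^'m^'m" and g :: "real \<Rightarrow> real^'m"
  defines "S \<equiv> legendre_zeros N"
  defines "h \<equiv> \<lambda>y. \<Sum>s\<in>S. poly (lagrange_basis S s) y *\<^sub>R g s"
  assumes bound: "\<And>s. s \<in> S \<Longrightarrow> g s \<bullet> (A *v g s) \<le> B"
  shows "set_integrable lborel {-1<..<1} (\<lambda>y. h y \<bullet> (A *v h y))"
    and "(LINT y:{-1<..<1}|lborel. h y \<bullet> (A *v h y)) \<le> 2 * B"
proof -
  let ?l = "\<lambda>s y. poly (lagrange_basis S s) y"
  let ?w = "\<lambda>s. LINT y:{-1<..<1}|lborel. ?l s y * ?l s y"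
  have A: "A *v h y = (\<Sum>t\<in>S. ?l t y *\<^sub>R (A *v g t))" for y
    unfolding h_def by (simp add: linear_sum[OF matrix_vector_mul_linear] matrix_vector_mult_scaleR)
  have eq: "h y \<bullet> (A *v h y) = (\<Sum>s\<in>S. \<Sum>t\<in>S. ?l s y * ?l t y * (g s \<bullet> (A *v g t)))" for y
    unfolding A unfolding h_def inner_sum_left inner_sum_right by (subst sum.swap) (simp add: mult_ac)
  show "set_integrable lborel {-1<..<1} (\<lambda>y. h y \<bullet> (A *v h y))"
    unfolding eq S_def by (rule integral_lagrange_quadratic(1))
  have "(LINT y:{-1<..<1}|lborel. h y \<bullet> (A *v h y)) = (\<Sum>s\<in>S. ?w s * (g s \<bullet> (A *v g s)))"
    unfolding eq S_def by (rule integral_lagrange_quadratic(2))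
  also have "\<dots> \<le> (\<Sum>s\<in>S. ?w s * B)"
    using bound by (intro sum_mono mult_left_mono)
      (auto simp: set_lebesgue_integral_def intro!: integral_nonneg_AE)
  also have "\<dots> = 2 * B"
    using sum_integral_lagrange_squares by (simp add: S_def sum_distrib_right[symmetric])
  finally show "(LINT y:{-1<..<1}|lborel. h y \<bullet> (A *v h y)) \<le> 2 * B" .
qed

text \<open>Interpolation is exact on each monomial of degree at most \<open>N - 1\<close>, and the
  vector coefficients factor out.\<close>

lemma lagrange_interpolation_vector_polynomial:
  fixes c :: "nat \<Rightarrow> 'a::real_vector"
  defines "S \<equiv> legendre_zeros N"
  assumes "n \<le> N - 1"
  shows "(\<Sum>s\<in>S. poly (lagrange_basis S s) y *\<^sub>R (\<Sum>k\<le>n. s ^ k *\<^sub>R c k)) = (\<Sum>k\<le>n. y ^ k *\<^sub>R c k)"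
proof -
  have "(\<Sum>s\<in>S. poly (lagrange_basis S s) y * s ^ k) = y ^ k" if "k \<le> n" for k
  proof -
    have "degree (monom 1 k :: real poly) < card S"
      using that assms(2) N card_zeros degree_monom_le[of "1 :: real" k] by (simp add: S_def)
    then have "monom 1 k = (\<Sum>s\<in>S. smult (poly (monom 1 k) s) (lagrange_basis S s))"
      using finite_legendre_zeros unfolding S_def by (intro lagrange_interpolation)
    from arg_cong[OF this, of "\<lambda>p. poly p y"] show ?thesis
      by (simp add: poly_sum poly_monom mult.commute)
  qed
  then show ?thesis
    by (simp add: scaleR_sum_right sum.swap[of _ "{..n}" S] scaleR_sum_left[symmetric])
qed

end


section \<open>The error estimate\<close>

text \<open>The squared estimate in pure matrix terms. The factor 8 is 4 + 4: the truncation error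
  and the interpolated error each contribute twice an integral of at most
  \<open>2 * B\<close>.\<close>

lemma subspace_solution_L2_error:
  fixes A0 A1 :: "real^'m^'m" and Q :: "real^'k^'m" and x xt :: "real \<Rightarrow> real^'m"
  assumes sym0: "transpose A0 = A0" and sym1: "transpose A1 = A1"
    and pd0: "\<And>z. z \<noteq> 0 \<Longrightarrow> z \<bullet> (A0 *v z) > 0" and psd1: "\<And>z. z \<bullet> (A1 *v z) \<ge> 0"
    and r: "0 < r" "r < 1"
    and dominated: "\<And>z. z \<bullet> (A1 *v z) \<le> (1 - r) * (z \<bullet> (A0 *v z))"
    and C: "C > 0" "\<And>z. z \<bullet> (A1 *v z) \<le> C * (z \<bullet> (A0 *v z))"
    and card: "card (legendre_zeros N) = N" and n: "N \<ge> 1" "n \<le> N - 1"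
    and x: "\<And>y. y \<in> {-1<..<1} \<Longrightarrow> param_matrix A0 A1 y *v x y = b"
    and Q: "span (columns Q) = span (x ` legendre_zeros N)"
    and xt: "\<And>y. y \<in> {-1<..<1} \<Longrightarrow> is_subspace_solution Q (param_matrix A0 A1 y) b (xt y)"
  shows "(LINT y:{-1<..<1}|lborel. (x y - xt y) \<bullet> (A0 *v (x y - xt y)))
      \<le> (1 + C) / r * (8 * ((1 - r) ^ (2 * (n + 1)) / r\<^sup>2 * (x 0 \<bullet> (A0 *v x 0))))"
proof -
  let ?S = "legendre_zeros N"
  let ?q = "\<lambda>z. z \<bullet> (A0 *v z)"
  \<comment> \<open>The square of the uniform truncation error \<epsilon>.\<close>
  define B where "B = (1 - r) ^ (2 * (n + 1)) / r\<^sup>2 * ?q (x 0)"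
  have psd0: "?q z \<ge> 0" for z
    using pd0[of z] by (cases "z = 0") auto
  have B: "B \<ge> 0"
    unfolding B_def using psd0 r by simp
  have inj: "inj ((*v) A0)"
  proof (rule injI)
    fix u v assume "A0 *v u = A0 *v v"
    then have "?q (u - v) = 0"
      by (simp add: matrix_vector_mult_diff_distrib)
    then show "u = v"
      using pd0[of "u - v"] by fastforce
  qed
  then have "invertible A0"
    by (metis invertible_left_inverse matrix_left_invertible_injective)
  define T where "T = (\<lambda>v. (matrix_inv A0 ** A1) *v v)"
  \<comment> \<open>\<open>matrix_inv\<close> is a choice, so its defining property comes from the
    existence of an inverse.\<close>
  have T: "A0 *v T v = A1 *v v" for v
    using someI_ex[OF \<open>invertible A0\<close>[unfolded invertible_def]]
    by (simp add: T_def matrix_inv_def matrix_vector_mul_assoc matrix_mul_assoc)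
  have linT: "linear T"
    unfolding T_def by (rule matrix_vector_mul_linear)
  have b: "A0 *v x 0 = b"
    using x[of 0] by (simp add: param_matrix_def)
  have x0: "x 0 = x y + y *\<^sub>R T (x y)" if "y \<in> {-1<..<1}" for y
  proof (rule injD[OF inj])
    show "A0 *v x 0 = A0 *v (x y + y *\<^sub>R T (x y))"
      using x[OF that] b T
      by (simp add: param_matrix_def matrix_vector_mult_add_rdistrib matrix_vector_right_distrib
          matrix_vector_mult_scaleR scaleR_matrix_vector_assoc[symmetric])
  qed
  \<comment> \<open>The signs go into the coefficients, so that \<open>p\<close> is a combination of
    plain monomials in y, as exactness of interpolation requires.\<close>
  define c where "c = (\<lambda>k. (- 1) ^ k *\<^sub>R (T ^^ k) (x 0))"
  define p where "p = (\<lambda>y. \<Sum>k\<le>n. y ^ k *\<^sub>R c k)"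
  have p: "?q (p y - x y) \<le> B" if y: "y \<in> {-1<..<1}" for y
  proof -
    have "p y = (\<Sum>k\<le>n. (- y) ^ k *\<^sub>R (T ^^ k) (x 0))"
      by (simp add: p_def c_def power_minus[of y] mult.commute)
    then have rem: "x y - p y = (- y) ^ (n + 1) *\<^sub>R (T ^^ (n + 1)) (x y)"
      using neumann_series_remainder[OF linT x0[OF y]] by simp
    have "?q (p y - x y) = ?q (x y - p y)"
      by (simp add: matrix_vector_mult_diff_distrib inner_diff_left inner_diff_right)
    also have "\<dots> = (y ^ (n + 1))\<^sup>2 * ?q ((T ^^ (n + 1)) (x y))"
      unfolding rem matrix_vector_mult_scaleR inner_scaleR_left inner_scaleR_right
      by (simp add: power2_eq_square power_minus[of y "n + 1"] mult.assoc
          flip: power_mult_distrib)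
    also have "\<dots> \<le> 1 * ((1 - r) ^ (2 * (n + 1)) * ?q (x y))"
      using y energy_iterate_le[OF sym0 sym1 psd0 psd1 dominated r T, of "n + 1" "x y"] psd0
      by (intro mult_mono) (auto simp: power_mult[symmetric] abs_square_le_1 abs_mult
          power_abs intro!: mult_le_one power_le_one)
    also have "\<dots> \<le> 1 * ((1 - r) ^ (2 * (n + 1)) * (?q (x 0) / r\<^sup>2))"
      using resolvent_bound[OF sym0 sym1 psd0 psd1 dominated r, of y "x y" "x 0"] x[OF y] b y r
      by (intro mult_left_mono) auto
    finally show ?thesis
      by (simp add: B_def)
  qed
  \<comment> \<open>\<open>h\<close> interpolates the error \<open>p - x\<close>, whose nodal
    energies are at most \<open>B\<close>. As \<open>p\<close> is reproduced, it equals
    \<open>p - v\<close>.\<close>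
  define h where "h = (\<lambda>y. \<Sum>s\<in>?S. poly (lagrange_basis ?S s) y *\<^sub>R (p s - x s))"
  define v where "v = (\<lambda>y. \<Sum>s\<in>?S. poly (lagrange_basis ?S s) y *\<^sub>R x s)"
  have h: "h y = p y - v y" for y
    using lagrange_interpolation_vector_polynomial[OF card n, of y c]
    by (simp add: h_def v_def p_def scaleR_diff_right sum_subtractf)
  have v: "v y \<in> span (columns Q)" for y
    unfolding Q v_def by (intro span_sum span_scale span_base) auto
  let ?b = "\<lambda>y. (1 + C) / r * (2 * B + 2 * ?q (h y))"
  have pointwise: "?q (x y - xt y) \<le> ?b y" if y: "y \<in> {-1<..<1}" for y
  proof -
    let ?A = "param_matrix A0 A1 y"
    have lower: "r * ?q z \<le> z \<bullet> (?A *v z)" for z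
      using param_matrix_lower_bound[OF sym0 sym1 psd0 psd1 dominated r, of y] y by auto
    have upper: "z \<bullet> (?A *v z) \<le> (1 + C) * ?q z" for z
    proof -
      \<comment> \<open>Negative y is covered too, since the \<open>A1\<close> energy is
        nonnegative.\<close>
      have "y * (z \<bullet> (A1 *v z)) \<le> 1 * (z \<bullet> (A1 *v z))"
        using y psd1 by (intro mult_right_mono) auto
      then show ?thesis
        using C(2)[of z] by (simp add: inner_param_matrix algebra_simps)
    qed
    have symA: "transpose ?A = ?A"
      using sym0 sym1 by (simp add: param_matrix_def transpose_def vec_eq_iff)
    have psdA: "z \<bullet> (?A *v z) \<ge> 0" for z
      using lower[of z] psd0[of z] r by (meson mult_nonneg_nonneg less_imp_le order_trans)
    have "r * ?q (x y - xt y) \<le> (x y - xt y) \<bullet> (?A *v (x y - xt y))"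
      by (rule lower)
    also have "\<dots> \<le> (x y - v y) \<bullet> (?A *v (x y - v y))"
      by (rule subspace_solution_quasi_optimal[OF symA psdA x[OF y] xt[OF y] v])
    also have "\<dots> \<le> (1 + C) * ?q (x y - v y)"
      by (rule upper)
    also have "\<dots> \<le> (1 + C) * (2 * B + 2 * ?q (h y))"
    proof -
      have "?q (x y - p y) = ?q (p y - x y)"
        by (simp add: matrix_vector_mult_diff_distrib inner_diff_left inner_diff_right)
      then have "?q (x y - v y) \<le> 2 * B + 2 * ?q (h y)"
        using psd_matrix_parallelogram[OF psd0, of "x y - p y" "h y"] p[OF y] by (simp add: h)
      then show ?thesis
        using C(1) by (intro mult_left_mono) auto
    qed
    finally show ?thesis
      using r by (simp add: pos_le_divide_eq mult.commute)
  qed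
  have inth: "set_integrable lborel {-1<..<1} (\<lambda>y. ?q (h y))"
    and leh: "(LINT y:{-1<..<1}|lborel. ?q (h y)) \<le> 2 * B"
    using lagrange_energy_integral[OF card n(1), of "\<lambda>s. p s - x s" A0 B] p
    unfolding h_def by auto
  have const: "set_integrable lborel {-1<..<1 :: real} (\<lambda>_. 2 * B)"
    using set_integrable_poly[of "[:2 * B:]"] by (simp add: poly_pCons[abs_def] del: set_integrable_mult_right_iff)
  have intb: "set_integrable lborel {-1<..<1} ?b"
    by (rule set_integrable_mult_right[OF set_integral_add(1)[OF const set_integrable_mult_right[OF inth]]])
  show ?thesis
  proof (cases "set_integrable lborel {-1<..<1} (\<lambda>y. ?q (x y - xt y))")
    case True
    have "(LINT y:{-1<..<1}|lborel. ?q (x y - xt y)) \<le> (LINT y:{-1<..<1}|lborel. ?b y)"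
      using True intb pointwise by (rule set_integral_mono)
    also have "\<dots> = (1 + C) / r * (4 * B + 2 * (LINT y:{-1<..<1}|lborel. ?q (h y)))"
      using set_integral_add(2)[OF const set_integrable_mult_right[OF inth, of 2]]
      by (simp add: set_lebesgue_integral_def)
    also have "\<dots> \<le> (1 + C) / r * (8 * B)"
      using leh C(1) r by (intro mult_left_mono) auto
    finally show ?thesis
      by (simp add: B_def)
  next
    \<comment> \<open>\<open>xt\<close> is not known to be measurable; the integral of a non-integrable function is \<open>0\<close>.\<close>
    case False
    then have "(LINT y:{-1<..<1}|lborel. ?q (x y - xt y)) = 0"
      by (simp add: set_lebesgue_integral_def set_integrable_def not_integrable_integral_eq)
    moreover have "0 \<le> (1 + C) / r * (8 * B)"
      using B C(1) r by simp
    ultimately show ?thesis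
      by (simp add: B_def)
  qed
qed


theorem corollary5p1:
  fixes \<Omega> :: "(real^'d) set"
    and L :: "(real^'d \<Rightarrow> real) \<Rightarrow> real"
    and a0 a1 :: "(real^'d \<Rightarrow> real) \<Rightarrow> (real^'d \<Rightarrow> real) \<Rightarrow> real"
    and r C :: real
    and Xh :: "(real^'d \<Rightarrow> real) set"
    and \<phi> :: "'m::finite \<Rightarrow> real^'d \<Rightarrow> real"
    and A0 A1 :: "real^'m^'m"
    and b :: "real^'m"
    and N n :: nat
    and ys w :: "nat \<Rightarrow> real"
    and x xt :: "real \<Rightarrow> real^'m"
    and Q :: "real^'k^'m"
  assumes "CARD('d) \<in> {2, 3}"
    and "lipschitz_domain \<Omega>"
    and "bounded_functional_on_H10 \<Omega> L"
    and "bilinear_form_on_H10 \<Omega> a0" "symmetric_on_H10 \<Omega> a0" "continuous_form_on_H10 \<Omega> a0"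
    and "bilinear_form_on_H10 \<Omega> a1" "symmetric_on_H10 \<Omega> a1" "continuous_form_on_H10 \<Omega> a1"
    and "coercive_on_H10 \<Omega> a0"
    and "positive_semidefinite_on_H10 \<Omega> a1"
    and "0 < r" "r < 1"
    and "\<forall>v\<in>H10 \<Omega>. a1 v v \<le> (1 - r) * a0 v v"
    and "C > 0"
    and "\<forall>v\<in>H10 \<Omega>. \<forall>z\<in>H10 \<Omega>. \<bar>a1 v z\<bar> \<le> C * sqrt (a0 v v) * sqrt (a0 z z)"
    and "subspace_of_H10 \<Omega> Xh"
    and "is_basis_of \<Omega> Xh \<phi>"
    and "A0 = galerkin_matrix a0 \<phi>"
    and "A1 = galerkin_matrix a1 \<phi>"
    and "b = load_vector L \<phi>"
    and "b \<noteq> 0"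
    and "N \<ge> 1"
    and "gauss_quadrature N ys w"
    and "\<forall>y\<in>{-1<..<1}. param_matrix A0 A1 y *v x y = b"
    and "is_basis_matrix Q (lagrange_subspace x (ys ` {1..N}))"
    and "\<forall>y\<in>{-1<..<1}. is_subspace_solution Q (param_matrix A0 A1 y) b (xt y)"
    and "n \<le> N - 1"
  shows "L2_energy_norm A0 (\<lambda>y. x y - xt y) / energy_norm A0 (x 0)
           \<le> sqrt ((1 + C) / r) * (sqrt 2 + sqrt (2 * (real n + 1))) * (4 / r\<^sup>2) * (1 - r) ^ (n + 1)"
proof -
  let ?S = "legendre_zeros N"
  let ?q = "\<lambda>z. z \<bullet> (A0 *v z)"
  let ?R = "(1 - r) ^ (n + 1)"
  let ?K = "sqrt ((1 + C) / r)"
  have \<phi>: "\<forall>i. \<phi> i \<in> Xh"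
    using assms by (simp add: is_basis_of_def)
  \<comment> \<open>Coordinate vectors as finite element functions; the hypotheses on the forms are
    pulled back along \<open>f\<close>.\<close>
  define f where "f = (\<lambda>u p. \<Sum>i\<in>UNIV. u $ i * \<phi> i p)"
  have f: "f u \<in> H10 \<Omega>" for u
    using subspace_of_H10_sum[OF \<open>subspace_of_H10 \<Omega> Xh\<close>, of UNIV \<phi> "($) u"] \<phi>
      \<open>subspace_of_H10 \<Omega> Xh\<close>
    by (auto simp: f_def subspace_of_H10_def)
  have A0: "u \<bullet> (A0 *v v) = a0 (f u) (f v)" for u v
    unfolding f_def \<open>A0 = _\<close> using assms \<phi> by (intro inner_galerkin_matrix) auto
  have A1: "u \<bullet> (A1 *v v) = a1 (f u) (f v)" for u v
    unfolding f_def \<open>A1 = _\<close> using assms \<phi> by (intro inner_galerkin_matrix) auto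
  have sym: "transpose A0 = A0" "transpose A1 = A1"
    using transpose_galerkin_matrix assms \<phi> by metis+
  have pd0: "?q z > 0" if "z \<noteq> 0" for z
    unfolding \<open>A0 = _\<close> using assms that by (intro galerkin_matrix_pos_def) auto
  have q: "?q z \<ge> 0" for z
    using pd0[of z] by (cases "z = 0") auto
  have psd1: "z \<bullet> (A1 *v z) \<ge> 0" for z
    using f \<open>positive_semidefinite_on_H10 \<Omega> a1\<close> by (simp add: A1 positive_semidefinite_on_H10_def)
  have dominated: "z \<bullet> (A1 *v z) \<le> (1 - r) * ?q z" for z
    unfolding A0 A1 using f \<open>\<forall>v\<in>H10 \<Omega>. a1 v v \<le> (1 - r) * a0 v v\<close> by blast
  have bounded: "z \<bullet> (A1 *v z) \<le> C * ?q z" for z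
  proof -
    \<comment> \<open>The continuity bound on the diagonal, where the two square roots multiply to
      the \<open>A0\<close> energy.\<close>
    have "\<bar>a1 (f z) (f z)\<bar> \<le> C * sqrt (a0 (f z) (f z)) * sqrt (a0 (f z) (f z))"
      using f assms by blast
    then show ?thesis
      using q[of z] by (simp add: A0 A1 mult.assoc)
  qed
  have S: "ys ` {1..N} = ?S" "card ?S = N"
    using \<open>gauss_quadrature N ys w\<close> bij_betw_same_card[of ys "{1..N}" ?S]
    by (auto simp: gauss_quadrature_def bij_betw_def)
  have "span (columns Q) = span (x ` ?S)"
    using assms S by (simp add: is_basis_matrix_def lagrange_subspace_def)
  then have "(LINT y:{-1<..<1}|lborel. ?q (x y - xt y))
      \<le> (1 + C) / r * (8 * ((1 - r) ^ (2 * (n + 1)) / r\<^sup>2 * ?q (x 0)))"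
    using subspace_solution_L2_error[OF sym pd0 psd1 \<open>0 < r\<close> \<open>r < 1\<close> dominated \<open>C > 0\<close> bounded S(2)
        \<open>N \<ge> 1\<close> \<open>n \<le> N - 1\<close>] assms by blast
  also have "\<dots> = (1 + C) / r * ((2 * sqrt 2 * ?R / r) ^ 2 * ?q (x 0))"
    by (simp only: power_mult power_mult_distrib power_divide power_even_eq mult_ac) simp
  finally have "L2_energy_norm A0 (\<lambda>y. x y - xt y)
      \<le> sqrt ((1 + C) / r * ((2 * sqrt 2 * ?R / r) ^ 2 * ?q (x 0)))"
    using q by (simp add: L2_energy_norm_def energy_norm_def)
  also have "\<dots> = ?K * (2 * sqrt 2 * ?R / r) * energy_norm A0 (x 0)"
    using \<open>0 < r\<close> \<open>r < 1\<close> unfolding real_sqrt_mult by (simp add: energy_norm_def)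
  also have "\<dots> \<le> ?K * ((sqrt 2 + sqrt (2 * (real n + 1))) * (4 / r\<^sup>2) * ?R) * energy_norm A0 (x 0)"
  proof -
    \<comment> \<open>The proved constant \<open>2 * sqrt 2 / r\<close> is weakened to the stated
      one: \<open>r < 1\<close> handles the power of r, and \<open>n \<ge> 0\<close> the
      roots.\<close>
    have "1 / r \<le> 4 / r\<^sup>2"
      using \<open>0 < r\<close> \<open>r < 1\<close> by (simp add: field_simps power2_eq_square)
    moreover have "2 * sqrt 2 \<le> sqrt 2 + sqrt (2 * (real n + 1))"
      by simp
    ultimately have "(2 * sqrt 2) * (1 / r) * ?R \<le> (sqrt 2 + sqrt (2 * (real n + 1))) * (4 / r\<^sup>2) * ?R"
      using \<open>0 < r\<close> \<open>r < 1\<close> by (intro mult_mono) auto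
    then show ?thesis
      using \<open>0 < r\<close> \<open>C > 0\<close> q
      by (intro mult_right_mono mult_left_mono) (auto simp: energy_norm_def)
  qed
  finally have main: "L2_energy_norm A0 (\<lambda>y. x y - xt y)
      \<le> ?K * ((sqrt 2 + sqrt (2 * (real n + 1))) * (4 / r\<^sup>2) * ?R) * energy_norm A0 (x 0)" .
  \<comment> \<open>\<open>b \<noteq> 0\<close> makes the denominator positive, so the bound may be
    divided by it.\<close>
  have "param_matrix A0 A1 0 *v x 0 = b"
    using assms by auto
  with \<open>b \<noteq> 0\<close> have "x 0 \<noteq> 0"
    by auto
  then have "energy_norm A0 (x 0) > 0"
    using pd0 by (simp add: energy_norm_def)
  with main show ?thesis
    by (simp add: pos_divide_le_eq mult.assoc)
qed

end
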